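(* For every dominant weight $\lambda$ of type $C_2$ there is an embedding of crystals $\Phi:\mathcal{B}(\lambda)\to\mathcal{B}(\lambda+2\varpi_1)$; that is, an injective weight-preserving map $\Phi$ such that for all $T\in\mathcal{B}(\lambda)$ and $i\in\{1,2\}$: if $f_i(T)\ne0$ then $f_i(\Phi(T))=\Phi(f_i(T))$, and if $e_i(T)\neq0$ then $e_i(\Phi(T))=\Phi(e_i(T))$.
   Context: $\mathfrak{g}=\mathfrak{sp}_4(\mathbb{C})$ with fundamental weights $\varpi_1,\varpi_2$ and simple roots $\alpha_1=2\varpi_1-\varpi_2$ (short), $\alpha_2=-2\varpi_1+2\varpi_2$ (long). For a dominant weight $\lambda$, $\mathcal{B}(\lambda)$ is the normal crystal of the irreducible $\mathfrak{g}$-module of highest weight $\lambda$, with weight map $\mathrm{wt}$ and crystal operators $e_i,f_i:\mathcal{B}(\lambda)\to\mathcal{B}(\lambda)\sqcup\{0\}$, $i=1,2$. *)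

theory Defs
  imports Main "HOL-Library.Product_Plus"
begin

section \<open>Weights of type \<open>C\<^sub>2\<close>\<close>

text \<open>The vertices of the Dynkin diagram, i.e. the index set \<open>{1, 2}\<close>: \<open>N1\<close> is attached to the short
  simple root and \<open>N2\<close> to the long one.\<close>

datatype node = N1 | N2

text \<open>A pair \<open>(a, b)\<close> stands for the integral weight \<open>a \<varpi>\<^sub>1 + b \<varpi>\<^sub>2\<close>. Hence its pairing with the
  \<open>i\<close>-th simple coroot is its \<open>i\<close>-th coordinate.\<close>

type_synonym weight = "int \<times> int"

fun fundamental_weight :: "node \<Rightarrow> weight" where
  "fundamental_weight N1 = (1, 0)"
| "fundamental_weight N2 = (0, 1)"

fun coroot_pairing :: "node \<Rightarrow> weight \<Rightarrow> int" where
  "coroot_pairing N1 \<mu> = fst \<mu>"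
| "coroot_pairing N2 \<mu> = snd \<mu>"

definition scale_weight :: "int \<Rightarrow> weight \<Rightarrow> weight" where
  "scale_weight n \<mu> = (n * fst \<mu>, n * snd \<mu>)"

fun simple_root :: "node \<Rightarrow> weight" where
  "simple_root N1 = scale_weight 2 (fundamental_weight N1) - fundamental_weight N2"
| "simple_root N2 = scale_weight (-2) (fundamental_weight N1) + scale_weight 2 (fundamental_weight N2)"

definition dominant :: "weight \<Rightarrow> bool" where
  "dominant \<mu> \<longleftrightarrow> (\<forall>i. 0 \<le> coroot_pairing i \<mu>)"


section \<open>Crystals and their embeddings\<close>

text \<open>\<open>None\<close> plays the role of the extra element \<open>0\<close> in the codomain of the crystal operators.\<close>

record 'b crystal =
  elems :: "'b set"
  wt :: "'b \<Rightarrow> weight"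
  e_op :: "node \<Rightarrow> 'b \<Rightarrow> 'b option"
  f_op :: "node \<Rightarrow> 'b \<Rightarrow> 'b option"

text \<open>An embedding need not be strict: \<open>\<Phi> T\<close> may admit a crystal operator that kills \<open>T\<close>.\<close>

definition crystal_embedding :: "'b crystal \<Rightarrow> 'c crystal \<Rightarrow> ('b \<Rightarrow> 'c) \<Rightarrow> bool" where
  "crystal_embedding B C \<Phi> \<longleftrightarrow>
     \<Phi> ` elems B \<subseteq> elems C \<and>
     inj_on \<Phi> (elems B) \<and>
     (\<forall>T\<in>elems B. wt C (\<Phi> T) = wt B T) \<and>
     (\<forall>T\<in>elems B. \<forall>i.
        (f_op B i T \<noteq> None \<longrightarrow> f_op C i (\<Phi> T) = map_option \<Phi> (f_op B i T)) \<and>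
        (e_op B i T \<noteq> None \<longrightarrow> e_op C i (\<Phi> T) = map_option \<Phi> (e_op B i T)))"


section \<open>The crystal of the vector representation\<close>

text \<open>The crystal graph of the four-dimensional representation is
  \<open>1 \<rightarrow>\<^sub>1 2 \<rightarrow>\<^sub>2 2' \<rightarrow>\<^sub>1 1'\<close>, where primes denote the barred letters. Its vertices are called
  \<open>L1\<close>, \<open>L2\<close>, \<open>L2'\<close>, \<open>L1'\<close> below.\<close>

datatype letter = L1 | L2 | L2' | L1'

fun letter_wt :: "letter \<Rightarrow> weight" where
  "letter_wt L1 = (1, 0)"
| "letter_wt L2 = (-1, 1)"
| "letter_wt L2' = (1, -1)"
| "letter_wt L1' = (-1, 0)"

fun letter_f :: "node \<Rightarrow> letter \<Rightarrow> letter option" where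
  "letter_f N1 L1 = Some L2"
| "letter_f N1 L2' = Some L1'"
| "letter_f N2 L2 = Some L2'"
| "letter_f _ _ = None"

fun letter_e :: "node \<Rightarrow> letter \<Rightarrow> letter option" where
  "letter_e N1 L2 = Some L1"
| "letter_e N1 L1' = Some L2'"
| "letter_e N2 L2' = Some L2"
| "letter_e _ _ = None"

text \<open>All \<open>i\<close>-strings have length at most one, so the string lengths \<open>\<epsilon>\<^sub>i\<close> and \<open>\<phi>\<^sub>i\<close> are 0 or 1.\<close>

definition letter_eps :: "node \<Rightarrow> letter \<Rightarrow> int" where
  "letter_eps i x = (if letter_e i x = None then 0 else 1)"

definition letter_phi :: "node \<Rightarrow> letter \<Rightarrow> int" where
  "letter_phi i x = (if letter_f i x = None then 0 else 1)"


section \<open>Tensor powers of the vector representation\<close>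

text \<open>A word \<open>[x\<^sub>1, \<dots>, x\<^sub>n]\<close> stands for \<open>x\<^sub>1 \<otimes> \<dots> \<otimes> x\<^sub>n\<close>, and the empty word for the element of the
  trivial crystal. The operations below are Kashiwara's tensor product rule, in his convention,
  applied to \<open>x \<otimes> (xs)\<close>:
  \<open>\<epsilon>\<^sub>i (b \<otimes> c) = max (\<epsilon>\<^sub>i b) (\<epsilon>\<^sub>i c - \<langle>wt b, \<alpha>\<^sub>i\<^sup>\<or>\<rangle>)\<close>;
  \<open>f\<^sub>i (b \<otimes> c)\<close> is \<open>f\<^sub>i b \<otimes> c\<close> if \<open>\<phi>\<^sub>i b > \<epsilon>\<^sub>i c\<close>, and \<open>b \<otimes> f\<^sub>i c\<close> otherwise;
  \<open>e\<^sub>i (b \<otimes> c)\<close> is \<open>e\<^sub>i b \<otimes> c\<close> if \<open>\<phi>\<^sub>i b \<ge> \<epsilon>\<^sub>i c\<close>, and \<open>b \<otimes> e\<^sub>i c\<close> otherwise.\<close>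

type_synonym word = "letter list"

fun word_wt :: "word \<Rightarrow> weight" where
  "word_wt [] = 0"
| "word_wt (x # xs) = letter_wt x + word_wt xs"

fun word_eps :: "node \<Rightarrow> word \<Rightarrow> int" where
  "word_eps i [] = 0"
| "word_eps i (x # xs) =
     max (letter_eps i x) (word_eps i xs - coroot_pairing i (letter_wt x))"

fun word_f :: "node \<Rightarrow> word \<Rightarrow> word option" where
  "word_f i [] = None"
| "word_f i (x # xs) =
     (if letter_phi i x > word_eps i xs
      then map_option (\<lambda>y. y # xs) (letter_f i x)
      else map_option (\<lambda>ys. x # ys) (word_f i xs))"

fun word_e :: "node \<Rightarrow> word \<Rightarrow> word option" where
  "word_e i [] = None"
| "word_e i (x # xs) =
     (if letter_phi i x \<ge> word_eps i xs
      then map_option (\<lambda>y. y # xs) (letter_e i x)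
      else map_option (\<lambda>ys. x # ys) (word_e i xs))"

inductive_set word_component :: "word \<Rightarrow> word set" for u :: word where
  base: "u \<in> word_component u"
| f_step: "v \<in> word_component u \<Longrightarrow> word_f i v = Some w \<Longrightarrow> w \<in> word_component u"
| e_step: "v \<in> word_component u \<Longrightarrow> word_e i v = Some w \<Longrightarrow> w \<in> word_component u"


section \<open>The normal crystal \<open>B(lam)\<close>\<close>

text \<open>For \<open>lam = a \<varpi>\<^sub>1 + b \<varpi>\<^sub>2\<close> dominant, the crystal of the irreducible module of highest weight \<open>lam\<close>
  is the connected component of \<open>u\<^sub>1\<^bsup>\<otimes>a\<^esup> \<otimes> u\<^sub>2\<^bsup>\<otimes>b\<^esup>\<close> in a tensor power of the vector crystal. Here
  \<open>u\<^sub>1 = 1\<close> and \<open>u\<^sub>2 = 1 \<otimes> 2\<close> are the highest weight elements of the crystals of the two fundamental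
  representations. For \<open>lam\<close> not dominant the definition below is meaningless.\<close>

definition highest_word :: "weight \<Rightarrow> word" where
  "highest_word lam =
     replicate (nat (fst lam)) L1 @ concat (replicate (nat (snd lam)) [L1, L2])"

definition normal_crystal :: "weight \<Rightarrow> word crystal" ("\<B>") where
  "\<B> lam = \<lparr>elems = word_component (highest_word lam), wt = word_wt, e_op = word_e, f_op = word_f\<rparr>"


section \<open>Consistency of the definitions\<close>

lemma word_eps_nonneg: "0 \<le> word_eps i w"
  by (induction w) (auto simp: letter_eps_def max_def)

lemma letter_phi_eq: "letter_phi i x = letter_eps i x + coroot_pairing i (letter_wt x)"
  by (cases i; cases x) (auto simp: letter_eps_def letter_phi_def)

lemma word_phi_nonneg: "0 \<le> word_eps i w + coroot_pairing i (word_wt w)"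
proof (induction w)
  case (Cons x xs)
  then show ?case
    by (cases i; cases x) (auto simp: letter_eps_def max_def)
qed (cases i; simp)

lemma word_e_eq_None_iff: "word_e i w = None \<longleftrightarrow> word_eps i w = 0"
proof (induction w)
  case (Cons x xs)
  then show ?case using word_eps_nonneg[of i xs]
    by (cases i; cases x) (auto simp: letter_eps_def letter_phi_def max_def)
qed simp

lemma word_f_eq_None_iff: "word_f i w = None \<longleftrightarrow> word_eps i w + coroot_pairing i (word_wt w) = 0"
proof (induction w)
  case (Cons x xs)
  then show ?case using word_eps_nonneg[of i xs] word_phi_nonneg[of i xs]
    by (cases i; cases x) (auto simp: letter_eps_def letter_phi_def max_def)
qed (cases i; simp)

lemma word_f_Some:
  "word_f i w = Some v \<Longrightarrow>
     word_eps i v = word_eps i w + 1 \<and> word_wt v = word_wt w - simple_root i \<and> word_e i v = Some w"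
proof (induction w arbitrary: v)
  case (Cons x xs)
  then show ?case using word_eps_nonneg[of i xs]
    by (cases i; cases x; cases "word_wt xs")
      (auto simp: letter_eps_def letter_phi_def max_def scale_weight_def split: if_splits)
qed simp

lemma word_e_Some:
  "word_e i w = Some v \<Longrightarrow>
     word_eps i v = word_eps i w - 1 \<and> word_wt v = word_wt w + simple_root i \<and> word_f i v = Some w"
proof (induction w arbitrary: v)
  case (Cons x xs)
  then show ?case using word_eps_nonneg[of i xs]
    by (cases i; cases x; cases "word_wt xs")
      (auto simp: letter_eps_def letter_phi_def max_def scale_weight_def split: if_splits)
qed simp

lemma highest_word_wt:
  assumes "dominant lam"
  shows "word_wt (highest_word lam) = lam"
proof -
  have app: "word_wt (v @ w) = word_wt v + word_wt w" for v w
    by (induction v) (auto simp: add.assoc)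
  have 1: "word_wt (replicate n L1) = (int n, 0)" for n
    by (induction n) (auto simp: zero_prod_def)
  have 2: "word_wt (concat (replicate n [L1, L2])) = (0, int n)" for n
    by (induction n) (auto simp: zero_prod_def)
  have "0 \<le> fst lam" "0 \<le> snd lam"
    using assms unfolding dominant_def by (metis coroot_pairing.simps)+
  then show ?thesis by (simp add: highest_word_def app 1 2)
qed

lemma highest_word_e: "word_e i (highest_word lam) = None"
proof -
  have 2: "word_eps i (concat (replicate n [L1, L2])) = 0" for i n
    by (cases i; induction n) (auto simp: letter_eps_def)
  have "word_eps i (replicate m L1 @ concat (replicate n [L1, L2])) = 0" for m n
    by (cases i; induction m) (auto simp: letter_eps_def 2)
  then show ?thesis by (simp add: word_e_eq_None_iff highest_word_def)
qed

end

theory Submission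
  imports Defs
begin

text \<open>For the node 1 the letters \<open>1'\<close> and \<open>1\<close> contribute a minus and a plus to the signature of a
  word, for the node 2 they contribute nothing. Hence \<open>w \<mapsto> 1' w 1\<close> surrounds the reduced signature
  by one minus on the left and one plus on the right, so whatever \<open>e\<^sub>i\<close> or \<open>f\<^sub>i\<close> does to \<open>w\<close> it still
  does inside \<open>1' w 1\<close>. Starting with the highest word of \<open>\<B> lam\<close>, the operators \<open>e\<^sub>1 e\<^sub>2 e\<^sub>1\<close> lead to
  the highest weight word \<open>1 1\<^sup>a (12)\<^sup>b 1\<close>. The crystal isomorphism between the components of
  \<open>1 2 1\<close> and \<open>1 1 2\<close> (a plactic relation) can be applied to three consecutive letters inside
  any word, and moves the last letter \<open>1\<close> past all the pairs \<open>12\<close>.\<close>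

section \<open>Concatenation of words\<close>

lemma coroot_pairing_add: "coroot_pairing i (\<mu> + \<nu>) = coroot_pairing i \<mu> + coroot_pairing i \<nu>"
  by (cases i) simp_all

lemma coroot_pairing_zero [simp]: "coroot_pairing i 0 = 0"
  by (cases i) simp_all

text \<open>The string length \<phi>: by \<open>word_f_eq_None_iff\<close> it vanishes exactly when
  the lowering operator kills the word.\<close>

definition word_phi :: "node \<Rightarrow> word \<Rightarrow> int" where
  "word_phi i w = word_eps i w + coroot_pairing i (word_wt w)"

lemma word_wt_append: "word_wt (v @ w) = word_wt v + word_wt w"
  by (induction v) (simp_all add: add.assoc)

lemma word_eps_append:
  "word_eps i (v @ w) = max (word_eps i v) (word_eps i w - coroot_pairing i (word_wt v))"
proof (induction v)
  case Nil
  then show ?case using word_eps_nonneg[of i w] by simp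
next
  case (Cons x v)
  then show ?case by (simp add: coroot_pairing_add max_def)
qed

lemma word_phi_Cons:
  "word_phi i (x # w) = max (letter_phi i x + coroot_pairing i (word_wt w)) (word_phi i w)"
  using letter_phi_eq[of i x] by (simp add: word_phi_def coroot_pairing_add max_def)

text \<open>Associativity of the tensor product: the rule that splits off one letter holds for every
  splitting of a word.\<close>

lemma word_f_append:
  "word_f i (v @ w) =
     (if word_phi i v > word_eps i w then map_option (\<lambda>v'. v' @ w) (word_f i v)
      else map_option (\<lambda>w'. v @ w') (word_f i w))"
proof (induction v)
  case Nil
  then show ?case using word_eps_nonneg[of i w]
    by (cases "word_f i w") (simp_all add: word_phi_def)
next
  case (Cons x v)
  have "word_phi i v = word_eps i v + coroot_pairing i (word_wt v)"
    by (simp add: word_phi_def)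
  then show ?case
    using Cons letter_phi_eq[of i x] word_phi_Cons[of i x v]
    by (auto simp: word_eps_append option.map_comp comp_def max_def split: if_splits)
qed

lemma word_e_append:
  "word_e i (v @ w) =
     (if word_phi i v \<ge> word_eps i w then map_option (\<lambda>v'. v' @ w) (word_e i v)
      else map_option (\<lambda>w'. v @ w') (word_e i w))"
proof (induction v)
  case Nil
  \<comment> \<open>With an empty left factor the test \<open>0 \<ge> word_eps i w\<close> succeeds
    only if \<open>word_e i w\<close> is \<open>None\<close>, so both sides agree.\<close>
  then show ?case using word_eps_nonneg[of i w] word_e_eq_None_iff[of i w]
    by (simp add: word_phi_def option.map_ident)
next
  case (Cons x v)
  have "word_phi i v = word_eps i v + coroot_pairing i (word_wt v)"
    by (simp add: word_phi_def)
  then show ?case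
    using Cons letter_phi_eq[of i x] word_phi_Cons[of i x v]
    by (auto simp: word_eps_append option.map_comp comp_def max_def split: if_splits)
qed

lemma length_word_f: "word_f i v = Some w \<Longrightarrow> length w = length v"
  by (induction v arbitrary: w) (auto split: if_splits)

lemma length_word_e: "word_e i v = Some w \<Longrightarrow> length w = length v"
  using length_word_f[of i w v] word_e_Some[of i v w] by simp


section \<open>Embeddings of word crystals\<close>

text \<open>Intermediate words, with a letter 1 after the pairs 12, need not be of the form
  \<open>highest_word lam\<close>.\<close>

definition component_crystal :: "word \<Rightarrow> word crystal" where
  "component_crystal u = \<lparr>elems = word_component u, wt = word_wt, e_op = word_e, f_op = word_f\<rparr>"

lemma normal_crystal_eq: "\<B> lam = component_crystal (highest_word lam)"
  by (simp add: normal_crystal_def component_crystal_def)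

lemma crystal_embedding_id: "crystal_embedding B B id"
  by (simp add: crystal_embedding_def option.map_id)

lemma crystal_embedding_comp:
  assumes "crystal_embedding B C \<Phi>" "crystal_embedding C D \<Psi>"
  shows "crystal_embedding B D (\<Psi> \<circ> \<Phi>)"
proof -
  have sub: "\<Phi> ` elems B \<subseteq> elems C"
    using assms(1) by (simp add: crystal_embedding_def)
  have "inj_on (\<Psi> \<circ> \<Phi>) (elems B)"
    using assms sub unfolding crystal_embedding_def by (metis comp_inj_on inj_on_subset)
  moreover have "f_op D i (\<Psi> (\<Phi> T)) = map_option (\<Psi> \<circ> \<Phi>) (f_op B i T)"
    if "T \<in> elems B" "f_op B i T \<noteq> None" for T i
    using that assms sub unfolding crystal_embedding_def
    by (metis image_subset_iff map_option_is_None option.map_comp)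
  moreover have "e_op D i (\<Psi> (\<Phi> T)) = map_option (\<Psi> \<circ> \<Phi>) (e_op B i T)"
    if "T \<in> elems B" "e_op B i T \<noteq> None" for T i
    using that assms sub unfolding crystal_embedding_def
    by (metis image_subset_iff map_option_is_None option.map_comp)
  ultimately show ?thesis
    using assms sub unfolding crystal_embedding_def by (simp add: image_subset_iff)
qed

text \<open>Arrows generate the component of \<open>u\<close> and \<open>g\<close> carries them to
  arrows, so only \<open>g u\<close> has to be placed in the target by hand.\<close>

lemma component_embedding:
  assumes base: "g u \<in> word_component v"
    and inj: "inj_on g (word_component u)"
    and wt: "\<And>w. w \<in> word_component u \<Longrightarrow> word_wt (g w) = word_wt w"
    and f: "\<And>i w w'. w \<in> word_component u \<Longrightarrow> word_f i w = Some w' \<Longrightarrow> word_f i (g w) = Some (g w')"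
    and e: "\<And>i w w'. w \<in> word_component u \<Longrightarrow> word_e i w = Some w' \<Longrightarrow> word_e i (g w) = Some (g w')"
  shows "crystal_embedding (component_crystal u) (component_crystal v) g"
proof -
  have "g w \<in> word_component v" if "w \<in> word_component u" for w
    using that
  proof induction
    case base
    then show ?case by (fact assms(1))
  next
    case (f_step w i w')
    then show ?case using f word_component.f_step by blast
  next
    case (e_step w i w')
    then show ?case using e word_component.e_step by blast
  qed
  then show ?thesis
    using inj wt f e by (auto simp: crystal_embedding_def component_crystal_def)
qed


section \<open>Strict isomorphisms and their tensor products\<close>

text \<open>Equality of options includes \<open>None\<close>, which is strictness. The
  \<open>set_option\<close> conditions make \<open>A\<close> a union of components. Preserved
  lengths allow concatenations to be split again.\<close>

definition strict_iso :: "word set \<Rightarrow> (word \<Rightarrow> word) \<Rightarrow> bool" where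
  "strict_iso A g \<longleftrightarrow> inj_on g A \<and>
     (\<forall>w\<in>A. length (g w) = length w \<and> word_wt (g w) = word_wt w \<and>
       (\<forall>i. word_eps i (g w) = word_eps i w \<and>
            word_f i (g w) = map_option g (word_f i w) \<and> set_option (word_f i w) \<subseteq> A \<and>
            word_e i (g w) = map_option g (word_e i w) \<and> set_option (word_e i w) \<subseteq> A))"

lemma strict_iso_id:
  assumes "\<And>i v w. v \<in> A \<Longrightarrow> word_f i v = Some w \<Longrightarrow> w \<in> A"
    and "\<And>i v w. v \<in> A \<Longrightarrow> word_e i v = Some w \<Longrightarrow> w \<in> A"
  shows "strict_iso A id"
  unfolding strict_iso_def
  by (simp add: option.map_id subset_iff elem_set) (meson assms)

lemma strict_iso_id_length: "strict_iso {w. length w = n} id"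
  by (rule strict_iso_id) (auto dest: length_word_f length_word_e)

text \<open>The tensor rule compares \<phi> of the left factor with \<epsilon> of the right one.
  Both are preserved, so the operators choose the same factor before and after. The common length
  \<open>n\<close> recovers the splitting from the word.\<close>

lemma strict_iso_tensor:
  assumes g: "strict_iso A g" and h: "strict_iso B h"
    and len: "\<And>v. v \<in> A \<Longrightarrow> length v = n"
  shows "strict_iso {v @ w |v w. v \<in> A \<and> w \<in> B} (\<lambda>u. g (take n u) @ h (drop n u))"
proof -
  define C where "C = {v @ w |v w. v \<in> A \<and> w \<in> B}"
  define k where "k = (\<lambda>u. g (take n u) @ h (drop n u))"
  have k: "k (v @ w) = g v @ h w" if "v \<in> A" for v w
    using len[OF that] by (simp add: k_def)
  have C: "v @ w \<in> C" if "v \<in> A" "w \<in> B" for v w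
    using that by (auto simp: C_def)
  have "inj_on k C"
  proof (rule inj_onI)
    fix x y
    assume "x \<in> C" "y \<in> C" and eq: "k x = k y"
    then obtain v w v' w' where x: "x = v @ w" "v \<in> A" "w \<in> B" and y: "y = v' @ w'" "v' \<in> A" "w' \<in> B"
      unfolding C_def by blast
    have "length (g v) = length (g v')"
      using g len x y unfolding strict_iso_def by metis
    then have "g v = g v'" "h w = h w'"
      using eq k x y by auto
    then show "x = y"
      using g h x y unfolding strict_iso_def by (metis inj_onD)
  qed
  moreover have "length (k u) = length u \<and> word_wt (k u) = word_wt u \<and>
       (\<forall>i. word_eps i (k u) = word_eps i u \<and>
            word_f i (k u) = map_option k (word_f i u) \<and> set_option (word_f i u) \<subseteq> C \<and>
            word_e i (k u) = map_option k (word_e i u) \<and> set_option (word_e i u) \<subseteq> C)"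
    if u_in: "u \<in> C" for u
  proof -
    obtain v w where u: "u = v @ w" and v: "v \<in> A" and w: "w \<in> B"
      using u_in unfolding C_def by blast
    have gv: "word_eps i (g v) = word_eps i v" "word_f i (g v) = map_option g (word_f i v)"
      "set_option (word_f i v) \<subseteq> A" "word_e i (g v) = map_option g (word_e i v)"
      "set_option (word_e i v) \<subseteq> A" for i
      using g v unfolding strict_iso_def by blast+
    have hw: "word_eps i (h w) = word_eps i w" "word_f i (h w) = map_option h (word_f i w)"
      "set_option (word_f i w) \<subseteq> B" "word_e i (h w) = map_option h (word_e i w)"
      "set_option (word_e i w) \<subseteq> B" for i
      using h w unfolding strict_iso_def by blast+
    have len_wt: "length (g v) = length v" "word_wt (g v) = word_wt v"
      "length (h w) = length w" "word_wt (h w) = word_wt w"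
      using g v h w unfolding strict_iso_def by blast+
    have phi: "word_phi i (g v) = word_phi i v" for i
      by (simp add: word_phi_def gv len_wt)
    have "word_f i (k u) = map_option k (word_f i u) \<and> set_option (word_f i u) \<subseteq> C" for i
      using gv(3)[of i] hw(3)[of i] v w
      by (cases "word_f i v"; cases "word_f i w") (simp_all add: u k C word_f_append phi gv hw)
    moreover have "word_e i (k u) = map_option k (word_e i u) \<and> set_option (word_e i u) \<subseteq> C" for i
      using gv(5)[of i] hw(5)[of i] v w
      by (cases "word_e i v"; cases "word_e i w") (simp_all add: u k C word_e_append phi gv hw)
    ultimately show ?thesis
      by (simp add: u k v gv hw len_wt word_wt_append word_eps_append)
  qed
  ultimately have "strict_iso C k"
    unfolding strict_iso_def by blast
  then show ?thesis
    unfolding C_def k_def .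
qed

lemma strict_iso_component:
  assumes g: "strict_iso A g" and u: "u \<in> A"
  shows "crystal_embedding (component_crystal u) (component_crystal (g u)) g"
proof (rule component_embedding)
  have f: "word_f i (g w) = map_option g (word_f i w)" "set_option (word_f i w) \<subseteq> A"
    and e: "word_e i (g w) = map_option g (word_e i w)" "set_option (word_e i w) \<subseteq> A"
    and wt: "word_wt (g w) = word_wt w"
    if w_in: "w \<in> A" for i w
    using g w_in unfolding strict_iso_def by blast+
  have A: "w \<in> A" if "w \<in> word_component u" for w
    using that
  proof induction
    case (f_step v i w)
    then show ?case using f(2)[of v i] by simp
  next
    case (e_step v i w)
    then show ?case using e(2)[of v i] by simp
  qed (fact u)
  show "g u \<in> word_component (g u)"
    by (rule word_component.base)
  show "inj_on g (word_component u)"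
    using g A unfolding strict_iso_def by (meson inj_on_subset subsetI)
  show "word_wt (g w) = word_wt w" if "w \<in> word_component u" for w
    using that by (simp add: wt A)
  show "word_f i (g w) = Some (g w')" if "w \<in> word_component u" "word_f i w = Some w'" for i w w'
    using that by (simp add: f A)
  show "word_e i (g w) = Some (g w')" if "w \<in> word_component u" "word_e i w = Some w'" for i w w'
    using that by (simp add: e A)
qed


section \<open>Moving the letter 1 past pairs 12\<close>

text \<open>The isomorphism from the component of \<open>1 2 1\<close> to the component of \<open>1 1 2\<close>; outside
  its domain \<open>swap\<close> is arbitrary.\<close>

definition swap_table :: "(word \<times> word) list" where
  "swap_table =
    [([L1, L2, L1], [L1, L1, L2]),
     ([L1, L2, L2], [L2, L1, L2]),
     ([L1, L2', L1], [L1, L1, L2']),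
     ([L2, L2', L1], [L2, L1, L2']),
     ([L2, L1', L1], [L2, L2, L2']),
     ([L2, L1', L2], [L2, L2, L1']),
     ([L2', L1', L1], [L2', L2, L2']),
     ([L2', L1', L2], [L2', L2, L1']),
     ([L2', L1', L2'], [L2', L2', L1']),
     ([L2', L1', L1'], [L1', L2', L1']),
     ([L1, L2', L2], [L2', L1, L2]),
     ([L2, L2', L2], [L1', L1, L2]),
     ([L1, L2', L2'], [L2', L1, L2']),
     ([L2, L2', L2'], [L1', L1, L2']),
     ([L2, L1', L2'], [L1', L2, L2']),
     ([L2, L1', L1'], [L1', L2, L1'])]"

definition swap :: "word \<Rightarrow> word" where
  "swap w = the (map_of swap_table w)"

definition swap_domain :: "word set" where
  "swap_domain = fst ` set swap_table"

text \<open>A finite check on sixteen words, as many as the dimension of the irreducible module of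
  highest weight \<varpi>1 + \<varpi>2.\<close>

lemma strict_iso_swap: "strict_iso swap_domain swap"
proof -
  have "inj_on swap swap_domain"
    by (simp add: inj_on_def swap_domain_def swap_table_def swap_def)
  moreover have "length (swap w) = length w \<and> word_wt (swap w) = word_wt w \<and>
       word_eps i (swap w) = word_eps i w \<and>
       word_f i (swap w) = map_option swap (word_f i w) \<and> set_option (word_f i w) \<subseteq> swap_domain \<and>
       word_e i (swap w) = map_option swap (word_e i w) \<and> set_option (word_e i w) \<subseteq> swap_domain"
    if "w \<in> swap_domain" for w i
    using that unfolding swap_domain_def swap_table_def
    by (cases i) (auto simp: swap_def swap_table_def letter_eps_def letter_phi_def)
  ultimately show ?thesis
    unfolding strict_iso_def by blast
qed

lemma swap_121: "swap [L1, L2, L1] = [L1, L1, L2]" "[L1, L2, L1] \<in> swap_domain"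
  by (simp_all add: swap_def swap_domain_def swap_table_def)

lemma component_embedding_swap:
  "\<exists>\<Phi>. crystal_embedding (component_crystal (p @ [L1, L2, L1] @ q))
                         (component_crystal (p @ [L1, L1, L2] @ q)) \<Phi>"
proof -
  let ?B = "{v @ w |v w. v \<in> swap_domain \<and> w \<in> UNIV}"
  let ?h = "\<lambda>u. swap (take 3 u) @ id (drop 3 u)"
  have "length v = 3" if "v \<in> swap_domain" for v
    using that by (auto simp: swap_domain_def swap_table_def)
  then have "strict_iso ?B ?h"
    using strict_iso_tensor[OF strict_iso_swap strict_iso_id[of UNIV]] by simp
  \<comment> \<open>The identity is now tensored on the left as well; there the factors need a
    common length, hence all words as long as \<open>p\<close>.\<close>
  then have iso: "strict_iso {v @ w |v w. v \<in> {v. length v = length p} \<and> w \<in> ?B}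
      (\<lambda>u. id (take (length p) u) @ ?h (drop (length p) u))" (is "strict_iso ?C ?k")
    by (rule strict_iso_tensor[OF strict_iso_id_length]) simp
  have "p @ [L1, L2, L1] @ q \<in> ?C"
    using swap_121(2) by blast
  from strict_iso_component[OF iso this] show ?thesis
    using swap_121(1) by (auto simp: numeral_3_eq_3)
qed

text \<open>The prefix is kept general so that the first pair can join it: the letter passes the
  other \<open>k\<close> pairs by induction, and one \<open>swap\<close> takes it past the
  first.\<close>

lemma component_embedding_move:
  "\<exists>\<Phi>. crystal_embedding (component_crystal (p @ concat (replicate k [L1, L2]) @ [L1] @ q))
                         (component_crystal (p @ [L1] @ concat (replicate k [L1, L2]) @ q)) \<Phi>"
proof (induction k arbitrary: p)
  case 0
  then show ?case using crystal_embedding_id by auto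
next
  case (Suc k)
  let ?r = "concat (replicate k [L1, L2])"
  obtain \<Phi> where \<Phi>: "crystal_embedding (component_crystal ((p @ [L1, L2]) @ ?r @ [L1] @ q))
      (component_crystal ((p @ [L1, L2]) @ [L1] @ ?r @ q)) \<Phi>"
    using Suc by blast
  obtain \<Psi> where "crystal_embedding (component_crystal (p @ [L1, L2, L1] @ ?r @ q))
      (component_crystal (p @ [L1, L1, L2] @ ?r @ q)) \<Psi>"
    using component_embedding_swap by blast
  with \<Phi> have "crystal_embedding (component_crystal (p @ [L1, L2] @ ?r @ [L1] @ q))
      (component_crystal (p @ [L1, L1, L2] @ ?r @ q)) (\<Psi> \<circ> \<Phi>)"
    using crystal_embedding_comp by force
  then show ?case by auto
qed


section \<open>Surrounding a word by \<open>1'\<close> and \<open>1\<close>\<close>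

text \<open>The letter \<open>L1'\<close> has \<phi> = 0 at both nodes, so the operator passes it
  by. The final \<open>L1\<close> has \<epsilon> = 0 < \<open>word_phi i w\<close>, so the operator
  acts on \<open>w\<close>.\<close>

lemma surround_f:
  assumes "word_f i w = Some w'"
  shows "word_f i (L1' # w @ [L1]) = Some (L1' # w' @ [L1])"
proof -
  have "word_phi i w > 0"
    using assms word_phi_nonneg[of i w] word_f_eq_None_iff[of i w] by (force simp: word_phi_def)
  then show ?thesis
    using assms word_eps_nonneg[of i "w @ [L1]"]
    by (cases i) (simp_all add: word_f_append letter_phi_def letter_eps_def)
qed

text \<open>This is \<open>surround_f\<close> read backwards, since the two operators are partial
  inverses.\<close>

lemma surround_e:
  assumes "word_e i w = Some w'"
  shows "word_e i (L1' # w @ [L1]) = Some (L1' # w' @ [L1])"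
proof -
  have "word_f i w' = Some w"
    using word_e_Some[OF assms] by simp
  then have "word_f i (L1' # w' @ [L1]) = Some (L1' # w @ [L1])"
    by (rule surround_f)
  then show ?thesis
    using word_f_Some by blast
qed

lemma component_embedding_surround:
  assumes "\<And>i. word_e i u = None"
  shows "crystal_embedding (component_crystal u) (component_crystal (L1 # u @ [L1]))
           (\<lambda>w. L1' # w @ [L1])"
proof (rule component_embedding)
  have eps: "word_eps i (u @ [L1]) = 0" for i
    using assms[of i] word_phi_nonneg[of i u] word_e_eq_None_iff[of i u]
    by (cases i) (auto simp: word_eps_append letter_eps_def)
  \<comment> \<open>As \<epsilon> of \<open>u @ [L1]\<close> is zero, the lowering operators act on
    the first letter and take it through the whole vector crystal.\<close>
  have "word_f N1 (L1 # u @ [L1]) = Some (L2 # u @ [L1])"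
    "word_f N2 (L2 # u @ [L1]) = Some (L2' # u @ [L1])"
    "word_f N1 (L2' # u @ [L1]) = Some (L1' # u @ [L1])"
    using eps by (simp_all add: letter_phi_def)
  then show "L1' # u @ [L1] \<in> word_component (L1 # u @ [L1])"
    using word_component.intros by meson
  show "inj_on (\<lambda>w. L1' # w @ [L1]) (word_component u)"
    by (simp add: inj_on_def)
  show "word_wt (L1' # w @ [L1]) = word_wt w" for w
    by (cases "word_wt w") (simp add: word_wt_append)
  show "word_f i (L1' # w @ [L1]) = Some (L1' # w' @ [L1])" if "word_f i w = Some w'" for i w w'
    using that by (rule surround_f)
  show "word_e i (L1' # w @ [L1]) = Some (L1' # w' @ [L1])" if "word_e i w = Some w'" for i w w'
    using that by (rule surround_e)
qed


theorem proposition3p1: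
  fixes lam :: weight
  assumes "dominant lam"
  shows "\<exists>\<Phi>. crystal_embedding (\<B> lam) (\<B> (lam + scale_weight 2 (fundamental_weight N1))) \<Phi>"
proof -
  let ?p = "replicate (nat (fst lam)) L1" and ?r = "concat (replicate (nat (snd lam)) [L1, L2])"
  have "0 \<le> fst lam"
    using assms unfolding dominant_def by (metis coroot_pairing.simps(1))
  then have "nat (fst lam + 2) = Suc (Suc (nat (fst lam)))"
    by linarith
  \<comment> \<open>Of the two new letters 1, one stands in front and the other between
    \<open>?p\<close> and \<open>?r\<close>, where the move past the pairs leaves it.\<close>
  then have top: "highest_word (lam + scale_weight 2 (fundamental_weight N1)) = (L1 # ?p) @ [L1] @ ?r @ []"
    by (simp add: highest_word_def scale_weight_def replicate_app_Cons_same)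
  obtain \<Psi> where "crystal_embedding (component_crystal ((L1 # ?p) @ ?r @ [L1] @ []))
      (component_crystal ((L1 # ?p) @ [L1] @ ?r @ [])) \<Psi>"
    using component_embedding_move by blast
  moreover have "L1 # highest_word lam @ [L1] = (L1 # ?p) @ ?r @ [L1] @ []"
    by (simp add: highest_word_def)
  ultimately have "crystal_embedding (component_crystal (L1 # highest_word lam @ [L1]))
      (component_crystal (highest_word (lam + scale_weight 2 (fundamental_weight N1)))) \<Psi>"
    unfolding top by simp
  then show ?thesis
    unfolding normal_crystal_eq
    using crystal_embedding_comp component_embedding_surround highest_word_e by blast
qed

end
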